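(* Let $\mathcal H=\{P_4, C_4\}$. Then for every integer $n\ge 4$, $\chi'_{\mathcal H}(n) = \lceil n/2\rceil+1$.
   Context: For a graph $G$ and a set $\mathcal H$ of small graphs, an $\mathcal H$-avoiding bipartite partition of $G$ is a collection of bipartite graphs $G_1,\dots,G_k$ (subgraphs of $G$, each without isolated vertices and nonempty) whose edge sets are pairwise disjoint with union $E(G)$, such that no $G_i$ contains any member of $\mathcal H$ as an induced subgraph. $\chi'_{\mathcal H}(G)$ is the smallest $k$ for which such a partition with $k$ graphs exists, and $\chi'_{\mathcal H}(n):=\chi'_{\mathcal H}(K_n)$, where $K_n$ is the complete graph on $n$ vertices. $P_4$ is the path on 4 vertices and $C_4$ the cycle on 4 vertices. *)

theory Defs
  imports Complex_Main
begin

record 'a graph =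
  verts :: "'a set"
  edges :: "'a set set"

definition simple_graph :: "'a graph \<Rightarrow> bool" where
  "simple_graph G \<longleftrightarrow>
     finite (verts G) \<and> (\<forall>e\<in>edges G. e \<subseteq> verts G \<and> card e = 2)"

definition subgraph :: "'a graph \<Rightarrow> 'a graph \<Rightarrow> bool" where
  "subgraph F G \<longleftrightarrow>
     simple_graph F \<and> verts F \<subseteq> verts G \<and> edges F \<subseteq> edges G"

definition bipartite :: "'a graph \<Rightarrow> bool" where
  "bipartite G \<longleftrightarrow>
     (\<exists>X Y. X \<inter> Y = {} \<and> X \<union> Y = verts G \<and>
            (\<forall>e\<in>edges G. \<exists>x\<in>X. \<exists>y\<in>Y. e = {x, y}))"

definition no_isolated_verts :: "'a graph \<Rightarrow> bool" where
  "no_isolated_verts G \<longleftrightarrow> (\<forall>v\<in>verts G. \<exists>e\<in>edges G. v \<in> e)"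

definition induced :: "'a graph \<Rightarrow> 'a set \<Rightarrow> 'a graph" where
  "induced G S = \<lparr>verts = S, edges = {e \<in> edges G. e \<subseteq> S}\<rparr>"

definition isomorphic :: "'a graph \<Rightarrow> 'b graph \<Rightarrow> bool" where
  "isomorphic G F \<longleftrightarrow>
     (\<exists>f. bij_betw f (verts G) (verts F) \<and>
          (\<forall>u\<in>verts G. \<forall>v\<in>verts G. {u, v} \<in> edges G \<longleftrightarrow> {f u, f v} \<in> edges F))"

definition contains_induced :: "'a graph \<Rightarrow> 'b graph \<Rightarrow> bool" where
  "contains_induced G F \<longleftrightarrow> (\<exists>S \<subseteq> verts G. isomorphic (induced G S) F)"

text \<open>The \<open>k\<close> parts are the graphs \<open>P i\<close> with \<open>i < k\<close>; values of \<open>P\<close> at other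
  indices are irrelevant.\<close>

definition avoiding_bipartite_partition ::
    "'b graph set \<Rightarrow> 'a graph \<Rightarrow> nat \<Rightarrow> (nat \<Rightarrow> 'a graph) \<Rightarrow> bool" where
  "avoiding_bipartite_partition \<H> G k P \<longleftrightarrow>
     (\<forall>i<k. subgraph (P i) G \<and> bipartite (P i) \<and>
            verts (P i) \<noteq> {} \<and> no_isolated_verts (P i)) \<and>
     (\<forall>i<k. \<forall>j<k. i \<noteq> j \<longrightarrow> edges (P i) \<inter> edges (P j) = {}) \<and>
     (\<Union>i<k. edges (P i)) = edges G \<and>
     (\<forall>i<k. \<forall>F\<in>\<H>. \<not> contains_induced (P i) F)"

definition avoiding_index :: "'b graph set \<Rightarrow> 'a graph \<Rightarrow> nat" where
  "avoiding_index \<H> G = (LEAST k. \<exists>P. avoiding_bipartite_partition \<H> G k P)"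

definition complete_graph :: "nat \<Rightarrow> nat graph" where
  "complete_graph n = \<lparr>verts = {..<n}, edges = {e. e \<subseteq> {..<n} \<and> card e = 2}\<rparr>"

definition P4 :: "nat graph" where
  "P4 = \<lparr>verts = {0, 1, 2, 3}, edges = {{0, 1}, {1, 2}, {2, 3}}\<rparr>"

definition C4 :: "nat graph" where
  "C4 = \<lparr>verts = {0, 1, 2, 3}, edges = {{0, 1}, {1, 2}, {2, 3}, {3, 0}}\<rparr>"

end

theory Submission
  imports Defs
begin

text \<open>
  A bipartite graph without induced \<open>P\<^sub>4\<close> and \<open>C\<^sub>4\<close> has no path on four vertices at all, so it is a
  star forest. Encode a star forest by the idempotent map sending each leaf to its centre and fixing
  every other vertex; the question is then how many such maps are needed to cover the edges of \<open>K\<^sub>n\<close>.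

  Lower bound: if no forest is a spanning star, each has at most \<open>n - 2\<close> edges and counting gives
  \<open>2k(n - 2) \<ge> n(n - 1) > (n + 1)(n - 2)\<close>. Otherwise delete the centre of a spanning star together
  with that star and induct.

  Upper bound: for \<open>n = 2m\<close> split the vertices into pairs \<open>{a\<^sub>i, b\<^sub>i}\<close>. The \<open>i\<close>-th forest has centres
  \<open>a\<^sub>i, b\<^sub>i\<close>, joined to \<open>a\<^sub>j, b\<^sub>j\<close> in parallel for \<open>i < j\<close> and crosswise for \<open>i > j\<close>; one further
  forest is the perfect matching of the edges \<open>a\<^sub>i b\<^sub>i\<close>. Odd \<open>n\<close> follows by deleting a vertex.
\<close>

section \<open>Star covers of complete graphs\<close>

text \<open>Fixed points are centres or isolated vertices. An edge may be covered repeatedly and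
  \<open>K\<close> is an arbitrary index set, so that vertices and indices can be deleted in an
  induction.\<close>

definition star_cover :: "'a set \<Rightarrow> 'b set \<Rightarrow> ('b \<Rightarrow> 'a \<Rightarrow> 'a) \<Rightarrow> bool" where
  "star_cover V K c \<longleftrightarrow>
     (\<forall>i\<in>K. \<forall>x\<in>V. c i x \<in> V \<and> c i (c i x) = c i x) \<and>
     (\<forall>u\<in>V. \<forall>v\<in>V. u \<noteq> v \<longrightarrow> (\<exists>i\<in>K. c i u = v \<or> c i v = u))"

lemma star_coverD:
  assumes "star_cover V K c"
  shows "i \<in> K \<Longrightarrow> x \<in> V \<Longrightarrow> c i x \<in> V"
    and "i \<in> K \<Longrightarrow> x \<in> V \<Longrightarrow> c i (c i x) = c i x"
    and "u \<in> V \<Longrightarrow> v \<in> V \<Longrightarrow> u \<noteq> v \<Longrightarrow> \<exists>i\<in>K. c i u = v \<or> c i v = u"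
  using assms unfolding star_cover_def by auto

text \<open>A leaf whose centre lies outside \<open>W\<close> becomes a fixed point; an edge inside
  \<open>W\<close> contains its own centre and so stays covered.\<close>

lemma star_cover_subset:
  assumes "star_cover V K c" "W \<subseteq> V"
  shows "star_cover W K (\<lambda>i x. if c i x \<in> W then c i x else x)"
  unfolding star_cover_def
proof (intro conjI ballI impI)
  fix u v assume "u \<in> W" "v \<in> W" "u \<noteq> v"
  then obtain i where "i \<in> K" "c i u = v \<or> c i v = u"
    using star_coverD(3)[OF assms(1)] assms(2) by blast
  then show "\<exists>i\<in>K. (if c i u \<in> W then c i u else u) = v \<or> (if c i v \<in> W then c i v else v) = u"
    using \<open>u \<in> W\<close> \<open>v \<in> W\<close> by (intro bexI[of _ i]) auto
qed (use star_coverD(2)[OF assms(1)] assms(2) in \<open>simp_all add: subsetD\<close>)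

text \<open>Every vertex of star \<open>i\<close> loses its centre \<open>v\<close>, so the
  restricted map of index \<open>i\<close> is the identity and covers nothing.\<close>

lemma star_cover_remove_spanning_star:
  assumes "star_cover V K c" "i \<in> K" "\<forall>x\<in>V. c i x = v"
  shows "\<exists>d. star_cover (V - {v}) (K - {i}) d"
proof -
  let ?d = "\<lambda>i x. if c i x \<in> V - {v} then c i x else x"
  have d: "star_cover (V - {v}) K ?d"
    using assms(1) by (rule star_cover_subset) auto
  have "star_cover (V - {v}) (K - {i}) ?d"
    unfolding star_cover_def
  proof (intro conjI ballI impI)
    fix x y assume xy: "x \<in> V - {v}" "y \<in> V - {v}" "x \<noteq> y"
    then obtain j where j: "j \<in> K" "?d j x = y \<or> ?d j y = x"
      using star_coverD(3)[OF d xy] by blast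
    have "?d i x = x" "?d i y = y" using xy assms(3) by simp_all
    then have "j \<noteq> i" using j(2) xy(3) by metis
    then show "\<exists>j\<in>K - {i}. ?d j x = y \<or> ?d j y = x" using j by blast
  next
    fix j x assume "j \<in> K - {i}" "x \<in> V - {v}"
    then show "?d j x \<in> V - {v}" "?d j (?d j x) = ?d j x"
      using star_coverD(1,2)[OF d, of j x] by blast+
  qed
  then show ?thesis by blast
qed

text \<open>Union bound: each edge of forest \<open>i\<close> is \<open>{x, c i x}\<close> for some
  leaf \<open>x\<close>.\<close>

lemma card_pairs_le_leaves:
  assumes "star_cover V K c" "finite V" "finite K"
  shows "card V choose 2 \<le> (\<Sum>i\<in>K. card {x\<in>V. c i x \<noteq> x})"
proof -
  let ?E = "\<lambda>i. (\<lambda>x. {x, c i x}) ` {x\<in>V. c i x \<noteq> x}"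
  have "{e. e \<subseteq> V \<and> card e = 2} \<subseteq> (\<Union>i\<in>K. ?E i)"
  proof
    fix e assume "e \<in> {e. e \<subseteq> V \<and> card e = 2}"
    then obtain u v where uv: "e = {u, v}" "u \<noteq> v" "u \<in> V" "v \<in> V"
      by (auto simp: card_2_iff)
    then obtain i where "i \<in> K" and i: "c i u = v \<or> c i v = u"
      using star_coverD(3)[OF assms(1), of u v] by blast
    from i have "e \<in> ?E i"
    proof
      assume "c i u = v"
      then show ?thesis using uv by (intro image_eqI[of _ _ u]) simp_all
    next
      assume "c i v = u"
      then show ?thesis using uv by (intro image_eqI[of _ _ v]) (simp_all add: insert_commute)
    qed
    then show "e \<in> (\<Union>i\<in>K. ?E i)" using \<open>i \<in> K\<close> by (rule UN_I[rotated])
  qed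
  then have "card {e. e \<subseteq> V \<and> card e = 2} \<le> card (\<Union>i\<in>K. ?E i)"
    using assms by (intro card_mono) auto
  also have "\<dots> \<le> (\<Sum>i\<in>K. card (?E i))"
    using assms(3) by (rule card_UN_le)
  also have "\<dots> \<le> (\<Sum>i\<in>K. card {x\<in>V. c i x \<noteq> x})"
    using assms(2) by (intro sum_mono card_image_le) auto
  finally show ?thesis using n_subsets[OF assms(2), of 2] by simp
qed

text \<open>By idempotence the two distinct values are fixed points, hence not leaves.\<close>

lemma card_leaves_le:
  assumes "star_cover V K c" "finite V" "i \<in> K" "x \<in> V" "y \<in> V" "c i x \<noteq> c i y"
  shows "card {x\<in>V. c i x \<noteq> x} \<le> card V - 2"
proof -
  have "{c i x, c i y} \<subseteq> V" "{x\<in>V. c i x \<noteq> x} \<subseteq> V - {c i x, c i y}"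
    using star_coverD[OF assms(1)] assms(3-5) by auto
  then have "card {x\<in>V. c i x \<noteq> x} \<le> card (V - {c i x, c i y})"
    using assms(2) by (intro card_mono) auto
  also have "\<dots> = card V - 2"
    using \<open>{c i x, c i y} \<subseteq> V\<close> assms(2,6) by (subst card_Diff_subset) auto
  finally show ?thesis .
qed

text \<open>The minimum keeps the induction going below the threshold \<open>n = 4\<close>, where fewer stars suffice.\<close>

lemma star_cover_lower_bound:
  assumes "star_cover V K c" "finite V" "finite K"
  shows "min (card V + 2) (2 * card V - 2) \<le> 2 * card K"
  using assms
proof (induction "card V" arbitrary: V K c)
  case 0
  then show ?case by simp
next
  case (Suc m)
  show ?case
  proof (cases "\<exists>i\<in>K. \<exists>v. \<forall>x\<in>V. c i x = v")
    case True
    then obtain i v where iv: "i \<in> K" "\<forall>x\<in>V. c i x = v" by blast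
    obtain x where "x \<in> V" using Suc.hyps(2) by fastforce
    then have "v \<in> V" using star_coverD(1)[OF Suc.prems(1) iv(1)] iv(2) by metis
    obtain d where "star_cover (V - {v}) (K - {i}) d"
      using star_cover_remove_spanning_star[OF Suc.prems(1) iv] by blast
    moreover have "m = card (V - {v})"
      using \<open>v \<in> V\<close> Suc by simp
    ultimately have "min (m + 2) (2 * m - 2) \<le> 2 * card (K - {i})"
      using Suc.hyps(1)[of "V - {v}" "K - {i}" d] Suc.prems by simp
    moreover have "card K = Suc (card (K - {i}))"
      using iv(1) Suc.prems(3) by (metis card.remove)
    \<comment> \<open>Removing one vertex and one index lowers the minimum by at most 2 and the
      right side by exactly 2.\<close>
    ultimately show ?thesis using Suc.hyps(2) by linarith
  next
    case False
    let ?n = "card V"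
    have "?n choose 2 \<le> (\<Sum>i\<in>K. card {x\<in>V. c i x \<noteq> x})"
      using card_pairs_le_leaves[OF Suc.prems] .
    also have "\<dots> \<le> (\<Sum>i\<in>K. ?n - 2)"
    proof (rule sum_mono)
      fix i assume i: "i \<in> K"
      obtain x where x: "x \<in> V" using Suc.hyps(2) by fastforce
      then obtain y where y: "y \<in> V" "c i x \<noteq> c i y" using False i by metis
      show "card {x\<in>V. c i x \<noteq> x} \<le> ?n - 2"
        using card_leaves_le[OF Suc.prems(1,2) i x y] .
    qed
    finally have "?n choose 2 \<le> card K * (?n - 2)" by simp
    moreover have "2 * (?n choose 2) = ?n * (?n - 1)"
      unfolding choose_two by (rule dvd_mult_div_cancel) (cases ?n; simp)
    ultimately have *: "?n * (?n - 1) \<le> (2 * card K) * (?n - 2)" by linarith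
    show ?thesis
    proof (cases "?n \<ge> 3")
      case True
      then obtain r where r: "?n = r + 3" by (metis add.commute le_Suc_ex)
      have "?n + 2 \<le> 2 * card K"
      proof (rule ccontr)
        assume "\<not> ?n + 2 \<le> 2 * card K"
        then have "2 * card K \<le> r + 4" using r by simp
        \<comment> \<open>With \<open>*\<close> this yields
          \<open>(r + 3) * (r + 2) \<le> (r + 4) * (r + 1)\<close>, whose left side is larger by
          2.\<close>
        then have "(2 * card K) * (r + 1) \<le> (r + 4) * (r + 1)" by (rule mult_le_mono1)
        then show False using * r by (simp add: algebra_simps)
      qed
      then show ?thesis by simp
    next
      case False
      then have "?n = 1 \<or> ?n = 2" using Suc.hyps(2) by linarith
      \<comment> \<open>For one vertex the minimum is 0; for two, \<open>*\<close> reads 2 \<le>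
        0.\<close>
      then show ?thesis using * by auto
    qed
  qed
qed

text \<open>Vertices \<open>2 * i\<close> and \<open>2 * i + 1\<close> form pair \<open>i\<close>,
  so \<open>x div 2\<close> is the pair of \<open>x\<close> and \<open>x mod 2\<close> its side. The
  branches are matching, centres, parallel and crosswise.\<close>

definition paired_star :: "nat \<Rightarrow> nat \<Rightarrow> nat \<Rightarrow> nat" where
  "paired_star m i x =
     (if i = m then 2 * (x div 2) + 1
      else if i = x div 2 then x
      else if i < x div 2 then 2 * i + x mod 2
      else 2 * i + (1 - x mod 2))"

lemma star_cover_paired_star: "star_cover {..<2 * m} {..m} (paired_star m)"
proof -
  \<comment> \<open>Index \<open>m\<close> covers edges inside a pair. Between two pairs, the index
    of the earlier one covers the edges joining equal sides, that of the later one the crossed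
    edges.\<close>
  have cov: "\<exists>i\<le>m. paired_star m i u = v \<or> paired_star m i v = u"
    if "u < 2 * m" "v < 2 * m" "u \<noteq> v" "u div 2 \<le> v div 2" for u v
  proof (cases "u div 2 = v div 2")
    case True
    then have "paired_star m m u = v \<or> paired_star m m v = u"
      using that(3) unfolding paired_star_def by presburger
    then show ?thesis by blast
  next
    case ne: False
    show ?thesis
    proof (cases "u mod 2 = v mod 2")
      case True
      then have "2 * (u div 2) + v mod 2 = u" by presburger
      then have "paired_star m (u div 2) v = u"
        using ne that unfolding paired_star_def by auto
      then show ?thesis using that by (intro exI[of _ "u div 2"]) auto
    next
      case False
      then have "2 * (v div 2) + (1 - u mod 2) = v" by presburger
      then have "paired_star m (v div 2) u = v"
        using ne that unfolding paired_star_def by auto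
      then show ?thesis using that by (intro exI[of _ "v div 2"]) auto
    qed
  qed
  have "paired_star m i x < 2 * m" if "i \<le> m" "x < 2 * m" for i x
    using that unfolding paired_star_def by (auto; presburger)
  moreover have "paired_star m i (paired_star m i x) = paired_star m i x"
    if "i \<le> m" "x < 2 * m" for i x
  proof -
    have "(2 * i + (1 - x mod 2)) div 2 = i" by presburger
    then show ?thesis unfolding paired_star_def by auto
  qed
  moreover have "\<exists>i\<le>m. paired_star m i u = v \<or> paired_star m i v = u"
    if "u < 2 * m" "v < 2 * m" "u \<noteq> v" for u v
    using cov[of u v] cov[of v u] that by (metis nat_le_linear)
  ultimately show ?thesis unfolding star_cover_def by (simp add: Bex_def)
qed

section \<open>Bipartite graphs without induced \<open>P\<^sub>4\<close> and \<open>C\<^sub>4\<close>\<close>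

text \<open>The path need not be induced, so one condition replaces both forbidden patterns.\<close>

definition has_path4 :: "'a graph \<Rightarrow> bool" where
  "has_path4 G \<longleftrightarrow> (\<exists>a b c d. distinct [a, b, c, d] \<and>
     {a, b} \<in> edges G \<and> {b, c} \<in> edges G \<and> {c, d} \<in> edges G)"

lemma has_path4_if_contains_induced:
  assumes "contains_induced G F" "F \<in> {P4, C4}"
  shows "has_path4 G"
proof -
  from assms(1) obtain S f where f: "bij_betw f S (verts F)"
    and e: "\<And>u v. u \<in> S \<Longrightarrow> v \<in> S \<Longrightarrow> ({u, v} \<in> edges (induced G S)) = ({f u, f v} \<in> edges F)"
    unfolding contains_induced_def isomorphic_def induced_def by auto
  let ?g = "inv_into S f"
  have V: "verts F = {0, 1, 2, 3}" using assms(2) by (auto simp: P4_def C4_def)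
  have g: "?g i \<in> S" "f (?g i) = i" if "i \<in> {0, 1, 2, 3}" for i
    using f V that by (auto simp: bij_betw_def f_inv_into_f inv_into_into)
  have path: "{i, j} \<in> edges F \<Longrightarrow> i \<in> {0, 1, 2, 3} \<Longrightarrow> j \<in> {0, 1, 2, 3} \<Longrightarrow> {?g i, ?g j} \<in> edges G" for i j
    using e[OF g(1) g(1), of i j] g(2)[of i] g(2)[of j] by (simp add: induced_def)
  have inj: "?g i \<noteq> ?g j" if "i \<in> {0, 1, 2, 3}" "j \<in> {0, 1, 2, 3}" "i \<noteq> j" for i j
    using g(2) that by metis
  have "{0, 1} \<in> edges F" "{1, 2} \<in> edges F" "{2, 3} \<in> edges F"
    using assms(2) by (auto simp: P4_def C4_def)
  then show ?thesis
    unfolding has_path4_def using path inj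
    by (intro exI[of _ "?g 0"] exI[of _ "?g 1"] exI[of _ "?g 2"] exI[of _ "?g 3"]) auto
qed

lemma bipartite_imp_two_colouring:
  assumes "bipartite G"
  obtains X where "\<And>u v. {u, v} \<in> edges G \<Longrightarrow> u \<in> X \<longleftrightarrow> v \<notin> X"
proof -
  obtain X Y where XY: "X \<inter> Y = {}" "\<forall>e\<in>edges G. \<exists>x\<in>X. \<exists>y\<in>Y. e = {x, y}"
    using assms unfolding bipartite_def by (elim exE conjE) (rule that)
  have "u \<in> X \<longleftrightarrow> v \<notin> X" if uv: "{u, v} \<in> edges G" for u v
  proof -
    obtain x y where "x \<in> X" "y \<in> Y" "{u, v} = {x, y}" using XY(2) uv by blast
    then show ?thesis using XY(1) by (auto simp: doubleton_eq_iff)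
  qed
  then show thesis by (rule that)
qed

text \<open>Bipartiteness excludes the chords \<open>{a, c}\<close> and \<open>{b, d}\<close>; the
  pair \<open>{a, d}\<close> alone decides between the two patterns.\<close>

lemma contains_induced_if_has_path4:
  assumes "simple_graph G" "bipartite G" "has_path4 G"
  shows "contains_induced G P4 \<or> contains_induced G C4"
proof -
  obtain a b c d where dist: "distinct [a, b, c, d]"
    and E: "{a, b} \<in> edges G" "{b, c} \<in> edges G" "{c, d} \<in> edges G"
    using assms(3) unfolding has_path4_def by blast
  obtain X where side: "\<And>u v. {u, v} \<in> edges G \<Longrightarrow> u \<in> X \<longleftrightarrow> v \<notin> X"
    using bipartite_imp_two_colouring[OF assms(2)] by metis
  have nE: "{a, c} \<notin> edges G" "{b, d} \<notin> edges G"
    using side[OF E(1)] side[OF E(2)] side[OF E(3)] side[of a c] side[of b d] by blast+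
  \<comment> \<open>\<open>isomorphic\<close> also compares a vertex with itself, so singleton edges
    must be excluded.\<close>
  have loop: "{u} \<notin> edges G" for u
    using assms(1) unfolding simple_graph_def by fastforce
  define f :: "'a \<Rightarrow> nat" where
    "f x = (if x = a then 0 else if x = b then 1 else if x = c then 2 else 3)" for x
  have f: "f a = 0" "f b = 1" "f c = 2" "f d = 3" using dist by (auto simp: f_def)
  let ?S = "{a, b, c, d}"
  have S: "?S \<subseteq> verts G" using E assms(1) unfolding simple_graph_def by blast
  have bij: "bij_betw f ?S {0, 1, 2, 3}" using f by (auto simp: bij_betw_def inj_on_def)
  show ?thesis
  proof (cases "{a, d} \<in> edges G")
    case True
    have "isomorphic (induced G ?S) C4"
      unfolding isomorphic_def
      by (intro exI[of _ f])
        (use bij E nE True loop in \<open>simp add: induced_def C4_def f doubleton_eq_iff insert_commute\<close>)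
    then show ?thesis using S unfolding contains_induced_def by blast
  next
    case False
    have "isomorphic (induced G ?S) P4"
      unfolding isomorphic_def
      by (intro exI[of _ f])
        (use bij E nE False loop in \<open>simp add: induced_def P4_def f doubleton_eq_iff insert_commute\<close>)
    then show ?thesis using S unfolding contains_induced_def by blast
  qed
qed

text \<open>The order on the vertices selects the centre of a single-edge component.\<close>

definition star_centre :: "'a::linorder graph \<Rightarrow> 'a \<Rightarrow> 'a" where
  "star_centre G x =
     (if \<exists>y. {z. {x, z} \<in> edges G} = {y} \<and> ({z. {y, z} \<in> edges G} = {x} \<longrightarrow> x < y)
      then THE y. {z. {x, z} \<in> edges G} = {y} else x)"

lemma star_centre_eq:
  assumes "{z. {x, z} \<in> edges G} = {y}" "{z. {y, z} \<in> edges G} = {x} \<longrightarrow> x < y"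
  shows "star_centre G x = y"
proof -
  have "\<exists>y. {z. {x, z} \<in> edges G} = {y} \<and> ({z. {y, z} \<in> edges G} = {x} \<longrightarrow> x < y)"
    using assms by (intro exI conjI)
  then have "star_centre G x = (THE y. {z. {x, z} \<in> edges G} = {y})"
    unfolding star_centre_def by (rule if_P)
  also have "\<dots> = y" unfolding assms(1) by simp
  finally show ?thesis .
qed

lemma star_centre_cases:
  obtains "star_centre G x = x"
  | y where "star_centre G x = y" "{z. {x, z} \<in> edges G} = {y}"
      "{z. {y, z} \<in> edges G} = {x} \<longrightarrow> x < y"
proof (cases "\<exists>y. {z. {x, z} \<in> edges G} = {y} \<and> ({z. {y, z} \<in> edges G} = {x} \<longrightarrow> x < y)")
  case True
  then obtain y where y: "{z. {x, z} \<in> edges G} = {y}" "{z. {y, z} \<in> edges G} = {x} \<longrightarrow> x < y"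
    by (elim exE conjE) (rule that)
  show thesis using star_centre_eq[OF y] y by (rule that(2))
next
  case False
  then have "star_centre G x = x" unfolding star_centre_def by (rule if_not_P)
  then show thesis by (rule that(1))
qed

lemma star_centre_idem: "star_centre G (star_centre G x) = star_centre G x"
proof (cases rule: star_centre_cases[of G x])
  case (2 y)
  then have "{y, x} \<in> edges G" by (auto simp: insert_commute)
  \<comment> \<open>If \<open>y\<close> moved too, \<open>x\<close> and \<open>y\<close> would be
    each other's only neighbours, and the order conditions would give both \<open>x < y\<close> and
    \<open>y < x\<close>.\<close>
  have "star_centre G y = y"
  proof (cases rule: star_centre_cases[of G y])
    case z: (2 z)
    have "x \<in> {z. {y, z} \<in> edges G}" using \<open>{y, x} \<in> edges G\<close> by simp
    then have "z = x" unfolding z(2) by simp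
    then show ?thesis using z(2,3) 2(2,3) by auto
  qed
  then show ?thesis using 2(1) by simp
qed simp

text \<open>If both ends had a further neighbour, these would differ for lack of triangles and
  extend the edge to a path on four vertices. So one end is a leaf; if both are, the smaller is sent
  to the larger.\<close>

lemma star_centre_covers:
  assumes "simple_graph G" "bipartite G" "\<not> has_path4 G" "{u, v} \<in> edges G"
  shows "star_centre G u = v \<or> star_centre G v = u"
proof -
  let ?N = "\<lambda>x. {z. {x, z} \<in> edges G}"
  have loop: "{w} \<notin> edges G" for w
    using assms(1) unfolding simple_graph_def by fastforce
  have triangle: False if "{a, u} \<in> edges G" "{v, a} \<in> edges G" for a
    using bipartite_imp_two_colouring[OF assms(2)] that assms(4) by metis
  have mem: "v \<in> ?N u" "u \<in> ?N v" using assms(4) by (auto simp: insert_commute)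
  have "?N u = {v} \<or> ?N v = {u}"
  proof (rule ccontr)
    assume "\<not> ?thesis"
    then obtain a b where ab: "{u, a} \<in> edges G" "a \<noteq> v" "{v, b} \<in> edges G" "b \<noteq> u"
      using mem by blast
    then have "a \<noteq> b" using triangle by (auto simp: insert_commute)
    moreover have "a \<noteq> u" "b \<noteq> v" "u \<noteq> v" using ab loop assms(4) by auto
    ultimately have "has_path4 G"
      unfolding has_path4_def using ab assms(4)
      by (intro exI[of _ a] exI[of _ u] exI[of _ v] exI[of _ b]) (auto simp: insert_commute)
    then show False using assms(3) by blast
  qed
  moreover have "u \<noteq> v" using loop assms(4) by auto
  ultimately show ?thesis
    using star_centre_eq[of u G v] star_centre_eq[of v G u] by (metis linorder_neqE)
qed

section \<open>Avoiding partitions and star covers\<close>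

lemma star_cover_if_partition:
  assumes "avoiding_bipartite_partition {P4, C4} (complete_graph n) k P"
  shows "star_cover {..<n} {..<k} (\<lambda>i. star_centre (P i))"
  unfolding star_cover_def
proof (intro conjI ballI impI)
  fix i x assume ix: "i \<in> {..<k}" "x \<in> {..<n}"
  have sub: "edges (P i) \<subseteq> edges (complete_graph n)"
    using assms ix unfolding avoiding_bipartite_partition_def subgraph_def by auto
  show "star_centre (P i) x \<in> {..<n}"
  proof (cases rule: star_centre_cases[of "P i" x])
    case (2 y)
    then have "{x, y} \<in> edges (P i)" by auto
    then show ?thesis using 2(1) sub by (auto simp: complete_graph_def)
  qed (use ix in simp)
  show "star_centre (P i) (star_centre (P i) x) = star_centre (P i) x"
    by (rule star_centre_idem)
next
  fix u v assume uv: "u \<in> {..<n}" "v \<in> {..<n}" "u \<noteq> v"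
  then have "{u, v} \<in> edges (complete_graph n)" by (simp add: complete_graph_def)
  then obtain i where i: "i < k" "{u, v} \<in> edges (P i)"
    using assms unfolding avoiding_bipartite_partition_def by blast
  have "simple_graph (P i)" "bipartite (P i)" "\<not> has_path4 (P i)"
    using assms i(1) contains_induced_if_has_path4[of "P i"]
    unfolding avoiding_bipartite_partition_def subgraph_def by auto
  then show "\<exists>i\<in>{..<k}. star_centre (P i) u = v \<or> star_centre (P i) v = u"
    using star_centre_covers i by blast
qed

text \<open>The leaf of the middle edge is not fixed and already has its centre, so it lies on no
  second edge.\<close>

lemma star_forest_no_path4:
  assumes "\<And>x y. {x, y} \<in> edges G \<Longrightarrow> f x = y \<or> f y = x"
    and "\<And>x. x \<in> \<Union>(edges G) \<Longrightarrow> f (f x) = f x"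
  shows "\<not> has_path4 G"
proof
  assume "has_path4 G"
  then obtain a b c d where "distinct [a, b, c, d]"
    and E: "{a, b} \<in> edges G" "{b, c} \<in> edges G" "{c, d} \<in> edges G"
    unfolding has_path4_def by blast
  moreover have "f (f a) = f a" "f (f b) = f b" "f (f c) = f c" "f (f d) = f d"
    using E by (auto intro!: assms(2))
  ultimately show False
    using assms(1)[OF E(1)] assms(1)[OF E(2)] assms(1)[OF E(3)] by auto
qed

text \<open>The colour classes are the fixed and the moved vertices.\<close>

lemma star_forest_bipartite:
  assumes "\<And>e. e \<in> edges G \<Longrightarrow> e \<subseteq> verts G \<and> card e = 2"
    and "\<And>x y. {x, y} \<in> edges G \<Longrightarrow> f x = y \<or> f y = x"
    and "\<And>x. x \<in> verts G \<Longrightarrow> f (f x) = f x"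
  shows "bipartite G"
  unfolding bipartite_def
proof (intro exI conjI ballI)
  fix e assume e: "e \<in> edges G"
  then obtain x y where xy: "e = {x, y}" "x \<noteq> y" "x \<in> verts G" "y \<in> verts G"
    using assms(1)[OF e] by (auto simp: card_2_iff)
  then have "f x = y \<or> f y = x" using assms(2) e by blast
  then show "\<exists>x\<in>{x \<in> verts G. f x = x}. \<exists>y\<in>{x \<in> verts G. f x \<noteq> x}. e = {x, y}"
  proof
    assume "f x = y"
    then have "f x \<noteq> x" "f y = y" "e = {y, x}"
      using xy(1,2) assms(3)[OF xy(3)] by auto
    then show ?thesis using xy(3,4) by blast
  next
    assume "f y = x"
    then have "f y \<noteq> y" "f x = x"
      using xy(2) assms(3)[OF xy(4)] by auto
    then show ?thesis using xy(1,3,4) by blast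
  qed
qed auto

text \<open>Giving each edge the least index that covers it makes the parts disjoint; the indices that
  are never used have to be dropped, since the parts of a partition are nonempty.\<close>

lemma partition_if_star_cover:
  fixes c :: "nat \<Rightarrow> nat \<Rightarrow> nat"
  assumes "star_cover {..<n} {..<k} c"
  shows "\<exists>k'\<le>k. \<exists>P. avoiding_bipartite_partition {P4, C4} (complete_graph n) k' P"
proof -
  let ?E = "edges (complete_graph n)"
  define covers where "covers i e \<longleftrightarrow> i < k \<and> (\<exists>x. e = {x, c i x})" for i e
  define col where "col e = (LEAST i. covers i e)" for e
  have E: "e \<subseteq> {..<n} \<and> card e = 2" if "e \<in> ?E" for e
    using that by (simp add: complete_graph_def)
  have col: "covers (col e) e" if e: "e \<in> ?E" for e
  proof -
    obtain u v where "e = {u, v}" "u \<noteq> v" "u < n" "v < n"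
      using E[OF e] by (auto simp: card_2_iff)
    moreover from this obtain i where "i < k" "c i u = v \<or> c i v = u"
      using star_coverD(3)[OF assms, of u v] by auto
    ultimately have "covers i e" unfolding covers_def by auto
    then show ?thesis unfolding col_def by (rule LeastI)
  qed
  define J where "J = col ` ?E"
  have J: "J \<subseteq> {..<k}" using col by (auto simp: J_def covers_def)
  then have "finite J" by (rule finite_subset) simp
  then obtain h where h: "bij_betw h {..<card J} J"
    using ex_bij_betw_nat_finite[of J] by (auto simp: atLeast0LessThan)
  \<comment> \<open>\<open>h\<close> renumbers the used indices consecutively; taking only the
    endpoints of edges as vertices rules out isolated ones.\<close>
  define P where "P i = (let F = {e \<in> ?E. col e = h i} in \<lparr>verts = \<Union>F, edges = F\<rparr>)" for i
  have eP: "edges (P i) = {e \<in> ?E. col e = h i}" and vP: "verts (P i) = \<Union>(edges (P i))" for i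
    by (simp_all add: P_def Let_def)
  have vn: "verts (P i) \<subseteq> {..<n}" for i using E by (auto simp: vP eP)
  have ne: "edges (P i) \<noteq> {}" if "i < card J" for i
  proof -
    have "h i \<in> J" using h that by (auto simp: bij_betw_def)
    then show ?thesis by (auto simp: eP J_def)
  qed
  have star: "c (h i) x = y \<or> c (h i) y = x" if "{x, y} \<in> edges (P i)" for i x y
    using col[of "{x, y}"] that unfolding eP covers_def by (auto simp: doubleton_eq_iff)
  have idem: "c (h i) (c (h i) x) = c (h i) x" if "i < card J" "x \<in> verts (P i)" for i x
  proof -
    have "h i \<in> J" using h that(1) by (auto simp: bij_betw_def)
    then show ?thesis using star_coverD(2)[OF assms] J vn that(2) by blast
  qed
  have "avoiding_bipartite_partition {P4, C4} (complete_graph n) (card J) P"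
    unfolding avoiding_bipartite_partition_def
  proof (intro conjI allI impI ballI)
    fix i assume i: "i < card J"
    show "subgraph (P i) (complete_graph n)"
    proof -
      have "finite (verts (P i))" using vn[of i] by (rule finite_subset) simp
      moreover have "verts (complete_graph n) = {..<n}" by (simp add: complete_graph_def)
      ultimately show ?thesis
        using vn[of i] E by (auto simp: subgraph_def simple_graph_def vP eP)
    qed
    show "bipartite (P i)"
    proof (rule star_forest_bipartite[where f = "c (h i)"])
      show "e \<subseteq> verts (P i) \<and> card e = 2" if "e \<in> edges (P i)" for e
        using that E by (auto simp: vP eP)
    qed (fact star, fact idem[OF i])
    show "verts (P i) \<noteq> {}"
    proof -
      obtain e where e: "e \<in> edges (P i)" using ne[OF i] by blast
      then have "e \<noteq> {}" using E[of e] by (auto simp: eP)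
      then show ?thesis using e unfolding vP by blast
    qed
    show "no_isolated_verts (P i)" by (auto simp: no_isolated_verts_def vP)
    fix F assume "F \<in> {P4, C4}"
    moreover have "\<not> has_path4 (P i)"
      by (rule star_forest_no_path4[where f = "c (h i)"])
        (fact star, fact idem[OF i, unfolded vP])
    ultimately show "\<not> contains_induced (P i) F" using has_path4_if_contains_induced by blast
  next
    fix i j assume "i < card J" "j < card J" "i \<noteq> j"
    then have "h i \<noteq> h j" using h by (auto simp: bij_betw_def inj_on_def)
    then show "edges (P i) \<inter> edges (P j) = {}" by (auto simp: eP)
  next
    have "\<exists>i<card J. col e = h i" if "e \<in> ?E" for e
    proof -
      have "col e \<in> h ` {..<card J}" using h that by (simp add: bij_betw_def J_def)
      then show ?thesis by auto
    qed
    then show "(\<Union>i<card J. edges (P i)) = ?E" by (auto simp: eP)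
  qed
  moreover have "card J \<le> k" using card_mono[OF _ J] by simp
  ultimately show ?thesis by blast
qed

theorem mainTheorem5:
  fixes n :: nat
  assumes "n \<ge> 4"
  shows "int (avoiding_index {P4, C4} (complete_graph n)) = \<lceil>real n / 2\<rceil> + 1"
proof -
  \<comment> \<open>\<open>2 * m\<close> is the least even number that is at least
    \<open>n\<close>.\<close>
  define m where "m = (n + 1) div 2"
  let ?Q = "\<lambda>k. \<exists>P. avoiding_bipartite_partition {P4, C4} (complete_graph n) k P"
  let ?k = "avoiding_index {P4, C4} (complete_graph n)"
  have "{..<n} \<subseteq> {..<2 * m}" unfolding m_def by auto
  from star_cover_subset[OF star_cover_paired_star this]
  obtain c where "star_cover {..<n} {..<Suc m} c" unfolding lessThan_Suc_atMost by blast
  then obtain k' where k': "k' \<le> Suc m" "?Q k'" using partition_if_star_cover by blast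
  have "?k \<le> k'" unfolding avoiding_index_def using k'(2) by (rule Least_le)
  have "?Q ?k" unfolding avoiding_index_def using k'(2) by (rule LeastI)
  then obtain P where "avoiding_bipartite_partition {P4, C4} (complete_graph n) ?k P" by blast
  from star_cover_lower_bound[OF star_cover_if_partition[OF this]]
  \<comment> \<open>For \<open>n \<ge> 4\<close> the minimum in the lower bound is
    \<open>n + 2\<close>.\<close>
  have "n + 2 \<le> 2 * ?k" using assms by simp
  then have "?k = m + 1" using \<open>?k \<le> k'\<close> k'(1) unfolding m_def by linarith
  moreover have "\<lceil>real n / 2\<rceil> = int m"
    unfolding m_def by (intro ceiling_unique) (auto simp: field_simps; linarith)+
  ultimately show ?thesis by simp
qed

end
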